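(* Even though $\mathcal{W}_1([0,1])\subset\mathcal{W}_1(\mathbb{R})$, not every isometry of $\mathcal{W}_1([0,1])$ can be extended to an isometry of $\mathcal{W}_1(\mathbb{R})$. Moreover, no subgroup of $\mathrm{Isom}(\mathcal{W}_1(\mathbb{R}))$ is isomorphic to $\mathrm{Isom}(\mathcal{W}_1([0,1]))$.
   Context: For $X=\mathbb{R}$ or $X=[0,1]$ with metric $|x-y|$, $\mathcal{W}_1(X)$ is the set of Borel probability measures $\mu$ on $X$ with $\int|x|\,d\mu(x)<\infty$, with the $1$-Wasserstein distance $d_{\mathcal{W}_1}(\mu,\nu)=\inf_{\pi}\int |x-y|\,d\pi(x,y)$, the infimum being over all couplings $\pi$ of $\mu$ and $\nu$. $\mathcal{W}_1([0,1])$ is regarded as the subset of $\mathcal{W}_1(\mathbb{R})$ of measures concentrated on $[0,1]$. An isometry of a metric space is a surjective distance preserving self-map; $\mathrm{Isom}$ denotes the group of isometries. *)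

theory Defs
  imports "HOL-Probability.Probability" "HOL-Algebra.Group"
begin

text \<open>
  Probability measures on a Borel set \<open>X\<close> of reals are represented as Borel measures
  on the whole line that are concentrated on \<open>X\<close>.
\<close>

definition wasserstein_space :: "real set \<Rightarrow> real measure set" where
  "wasserstein_space X =
     {\<mu>. prob_space \<mu> \<and> sets \<mu> = sets borel \<and> (AE x in \<mu>. x \<in> X) \<and>
         integrable \<mu> (\<lambda>x. \<bar>x\<bar>)}"

definition couplings :: "real measure \<Rightarrow> real measure \<Rightarrow> (real \<times> real) measure set" where
  "couplings \<mu> \<nu> =
     {\<pi>. prob_space \<pi> \<and> sets \<pi> = sets (borel \<Otimes>\<^sub>M borel) \<and>
         distr \<pi> borel fst = \<mu> \<and> distr \<pi> borel snd = \<nu>}"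

text \<open>
  The infimum is taken in \<open>[0, \<infinity>]\<close>; it is finite for measures with finite first moment, so the
  conversion to a real number loses nothing there. A coupling of two measures concentrated on a
  Borel set \<open>X\<close> is itself concentrated on \<open>X \<times> X\<close>, so the distance does not depend on whether the
  measures are viewed on \<open>X\<close> or on the line.
\<close>

definition wasserstein_dist :: "real measure \<Rightarrow> real measure \<Rightarrow> real" where
  "wasserstein_dist \<mu> \<nu> =
     enn2real (INF \<pi>\<in>couplings \<mu> \<nu>. \<integral>\<^sup>+ p. ennreal \<bar>fst p - snd p\<bar> \<partial>\<pi>)"

text \<open>
  As in HOL-Algebra's \<open>BijGroup\<close>, self-maps of \<open>M\<close> are represented by functions that are
  \<open>undefined\<close> off \<open>M\<close>, so that equality of group elements is equality of maps on \<open>M\<close>.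
\<close>

definition isometries :: "'a set \<Rightarrow> ('a \<Rightarrow> 'a \<Rightarrow> real) \<Rightarrow> ('a \<Rightarrow> 'a) set" where
  "isometries M d =
     {f \<in> extensional M. f ` M = M \<and> (\<forall>x\<in>M. \<forall>y\<in>M. d (f x) (f y) = d x y)}"

definition isom_group :: "'a set \<Rightarrow> ('a \<Rightarrow> 'a \<Rightarrow> real) \<Rightarrow> ('a \<Rightarrow> 'a) monoid" where
  "isom_group M d = \<lparr>carrier = isometries M d, mult = compose M, one = (\<lambda>x\<in>M. x)\<rparr>"

lemma group_isom_group:
  assumes "Metric_space M d"
  shows "group (isom_group M d)"
proof (rule groupI)
  interpret Metric_space M d by (rule assms)
  fix f assume f: "f \<in> carrier (isom_group M d)"
  then have img: "f ` M = M"
    and pres: "\<And>x y. x \<in> M \<Longrightarrow> y \<in> M \<Longrightarrow> d (f x) (f y) = d x y"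
    by (auto simp: isom_group_def isometries_def)
  have inj: "inj_on f M"
  proof (rule inj_onI)
    fix x y assume xy: "x \<in> M" "y \<in> M" "f x = f y"
    have "f y \<in> M" using img xy by blast
    then have "d x y = 0" using pres[of x y] xy by simp
    then show "x = y" using xy by simp
  qed
  let ?g = "\<lambda>x\<in>M. inv_into M f x"
  have bij: "bij_betw f M M" using inj img by (simp add: bij_betw_def)
  have gM: "?g ` M = M"
    using bij_betw_inv_into[OF bij] by (simp add: bij_betw_def)
  have "d (inv_into M f x) (inv_into M f y) = d x y" if "x \<in> M" "y \<in> M" for x y
    using pres[of "inv_into M f x" "inv_into M f y"] that img
    by (simp add: inv_into_into f_inv_into_f)
  then have "?g \<in> carrier (isom_group M d)"
    using gM by (simp add: isom_group_def isometries_def)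
  moreover have "compose M ?g f = (\<lambda>x\<in>M. x)"
    using inj img by (auto simp: compose_def fun_eq_iff)
  ultimately show "\<exists>g\<in>carrier (isom_group M d). g \<otimes>\<^bsub>isom_group M d\<^esub> f = \<one>\<^bsub>isom_group M d\<^esub>"
    by (auto simp: isom_group_def)
next
  fix f g assume fg: "f \<in> carrier (isom_group M d)" "g \<in> carrier (isom_group M d)"
  then have "compose M f g ` M = M"
    by (simp add: isom_group_def isometries_def compose_def flip: image_image)
  moreover have "d (f (g x)) (f (g y)) = d x y" if "x \<in> M" "y \<in> M" for x y
  proof -
    have "g x \<in> M" "g y \<in> M"
      using fg(2) that by (auto simp: isom_group_def isometries_def)
    then show ?thesis
      using fg that by (simp add: isom_group_def isometries_def)
  qed
  ultimately show "f \<otimes>\<^bsub>isom_group M d\<^esub> g \<in> carrier (isom_group M d)"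
    by (simp add: isom_group_def isometries_def compose_def)
next
  fix f g h assume "f \<in> carrier (isom_group M d)" "g \<in> carrier (isom_group M d)"
    "h \<in> carrier (isom_group M d)"
  then show "f \<otimes>\<^bsub>isom_group M d\<^esub> g \<otimes>\<^bsub>isom_group M d\<^esub> h =
      f \<otimes>\<^bsub>isom_group M d\<^esub> (g \<otimes>\<^bsub>isom_group M d\<^esub> h)"
    by (auto simp: isom_group_def isometries_def compose_def restrict_def fun_eq_iff)
next
  fix f assume "f \<in> carrier (isom_group M d)"
  then show "\<one>\<^bsub>isom_group M d\<^esub> \<otimes>\<^bsub>isom_group M d\<^esub> f = f"
    by (auto simp: isom_group_def isometries_def compose_def restrict_def fun_eq_iff extensional_def)
qed (auto simp: isom_group_def isometries_def)

end

theory Submission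
  imports Defs
begin

text \<open>
  A measure \<open>\<mu>\<close> on the line is a Dirac mass iff every geodesic starting at \<open>\<mu>\<close> can be prolonged:
  dilations prolong geodesics issuing from a Dirac mass, while a geodesic from \<open>\<mu>\<close> to \<open>\<delta>\<^sub>c\<close> cannot be
  prolonged when \<open>\<mu>\<close> has mass on both sides of \<open>c\<close>. Hence isometries of the space over the line
  permute the Dirac masses. As \<open>\<mu>\<close> is determined by its distances to all Dirac masses, an isometry
  is determined by the isometry of the line so obtained; and in the isometry group of the line, two
  distinct reflections never commute.

  Over \<open>[0,1]\<close>, exchanging the distribution function with the quantile function is an isometric
  involution, because the Wasserstein distance is the area between the graphs. It maps \<open>\<delta>\<^sub>1\<^sub>/\<^sub>2\<close> to a
  measure with two atoms, so it does not extend to the line; and it commutes with the reflection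
  \<open>x \<mapsto> 1 - x\<close>, giving a Klein four-group.
\<close>

section \<open>Membership in the Wasserstein space: moments, push-forwards, Dirac masses\<close>

lemma wasserstein_spaceD:
  assumes "\<mu> \<in> wasserstein_space X"
  shows "real_distribution \<mu>" "prob_space \<mu>" "sets \<mu> = sets borel" "space \<mu> = UNIV"
    "AE x in \<mu>. x \<in> X" "integrable \<mu> (\<lambda>x. \<bar>x\<bar>)"
proof -
  show *: "prob_space \<mu>" "sets \<mu> = sets borel" "AE x in \<mu>. x \<in> X" "integrable \<mu> (\<lambda>x. \<bar>x\<bar>)"
    using assms by (auto simp: wasserstein_space_def)
  then show "real_distribution \<mu>"
    by (simp add: real_distribution_def real_distribution_axioms_def)
  show "space \<mu> = UNIV"
    using sets_eq_imp_space_eq[OF *(2)] by simp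
qed

lemma wasserstein_space_mono: "X \<subseteq> Y \<Longrightarrow> wasserstein_space X \<subseteq> wasserstein_space Y"
  unfolding wasserstein_space_def by (auto elim: eventually_mono)

lemma integrable_abs_diff_const:
  assumes "\<mu> \<in> wasserstein_space X"
  shows "integrable \<mu> (\<lambda>x. \<bar>x - c\<bar>)"
proof -
  interpret real_distribution \<mu> using assms by (rule wasserstein_spaceD)
  have "integrable \<mu> (\<lambda>x. \<bar>x\<bar>)"
    using assms by (rule wasserstein_spaceD)
  then have "integrable \<mu> (\<lambda>x. \<bar>x\<bar> + \<bar>c\<bar>)" by simp
  then show ?thesis by (rule Bochner_Integration.integrable_bound) auto
qed

lemma distr_in_wasserstein_space:
  assumes "prob_space P" and [measurable]: "f \<in> borel_measurable P"
    and "AE x in P. f x \<in> X" and [measurable]: "X \<in> sets borel"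
    and "integrable P (\<lambda>x. \<bar>f x\<bar>)"
  shows "distr P borel f \<in> wasserstein_space X"
  using assms unfolding wasserstein_space_def
  by (simp add: prob_space.prob_space_distr AE_distr_iff integrable_distr_eq)

lemma return_in_wasserstein_space:
  assumes "c \<in> X" and [measurable]: "X \<in> sets borel"
  shows "return borel c \<in> wasserstein_space X"
proof -
  interpret prob_space "return borel c" by (rule prob_space_return) simp
  have "AE x in return borel c. x = c"
    by (simp add: AE_return)
  then have "integrable (return borel c) (\<lambda>x. \<bar>x\<bar>)"
    by (intro integrable_const_bound[where B="\<bar>c\<bar>"]) auto
  then show ?thesis
    using assms prob_space_axioms by (auto simp: wasserstein_space_def AE_return)
qed

lemma eq_returnI:
  assumes "real_distribution \<mu>" "AE x in \<mu>. x = c"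
  shows "\<mu> = return borel c"
proof (rule measure_eqI)
  interpret real_distribution \<mu> by fact
  show "sets \<mu> = sets (return borel c)" by simp
  fix A assume "A \<in> sets \<mu>"
  then have [measurable]: "A \<in> sets borel" by simp
  have "emeasure \<mu> A = emeasure \<mu> (if c \<in> A then space \<mu> else {})"
    using assms(2) by (intro emeasure_eq_AE) auto
  then show "emeasure \<mu> A = emeasure (return borel c) A"
    by (simp add: emeasure_return indicator_def emeasure_space_1 del: space_eq_univ)
qed

section \<open>Couplings, and bounds for the distance from above and below\<close>

lemma coupling_distr:
  assumes "prob_space P" and [measurable]: "f \<in> borel_measurable P" "g \<in> borel_measurable P"
  shows "distr P (borel \<Otimes>\<^sub>M borel) (\<lambda>x. (f x, g x)) \<in> couplings (distr P borel f) (distr P borel g)"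
  using assms unfolding couplings_def
  by (simp add: prob_space.prob_space_distr distr_distr comp_def)

lemma couplingD:
  assumes "\<pi> \<in> couplings \<mu> \<nu>"
  shows "prob_space \<pi>" "sets \<pi> = sets (borel \<Otimes>\<^sub>M borel)"
    "fst \<in> borel_measurable \<pi>" "snd \<in> borel_measurable \<pi>"
    "distr \<pi> borel fst = \<mu>" "distr \<pi> borel snd = \<nu>"
proof -
  show "prob_space \<pi>" "distr \<pi> borel fst = \<mu>" "distr \<pi> borel snd = \<nu>"
    using assms by (auto simp: couplings_def)
  show [measurable_cong]: "sets \<pi> = sets (borel \<Otimes>\<^sub>M borel)"
    using assms by (simp add: couplings_def)
  show "fst \<in> borel_measurable \<pi>" "snd \<in> borel_measurable \<pi>"
    by measurable
qed

text \<open>Two random variables on one probability space give a coupling of their laws. Every upper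
  bound for the distance below comes from such an explicit coupling.\<close>

lemma wasserstein_dist_distr_le:
  assumes "prob_space P" and [measurable]: "f \<in> borel_measurable P" "g \<in> borel_measurable P"
    and int: "integrable P (\<lambda>x. \<bar>f x - g x\<bar>)"
  shows "wasserstein_dist (distr P borel f) (distr P borel g) \<le> (\<integral>x. \<bar>f x - g x\<bar> \<partial>P)"
proof -
  let ?\<pi> = "distr P (borel \<Otimes>\<^sub>M borel) (\<lambda>x. (f x, g x))"
  have "(INF \<pi>\<in>couplings (distr P borel f) (distr P borel g). \<integral>\<^sup>+ p. ennreal \<bar>fst p - snd p\<bar> \<partial>\<pi>)
      \<le> (\<integral>\<^sup>+ p. ennreal \<bar>fst p - snd p\<bar> \<partial>?\<pi>)"
    using coupling_distr[OF assms(1-3)] by (rule INF_lower)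
  also have "\<dots> = (\<integral>\<^sup>+ x. ennreal \<bar>f x - g x\<bar> \<partial>P)"
    by (subst nn_integral_distr) auto
  also have "\<dots> = ennreal (\<integral>x. \<bar>f x - g x\<bar> \<partial>P)"
    using int by (intro nn_integral_eq_integral) auto
  finally show ?thesis
    unfolding wasserstein_dist_def by (intro enn2real_leI) auto
qed

lemma integrable_coupling:
  assumes "\<mu> \<in> wasserstein_space X" "\<nu> \<in> wasserstein_space Y" and \<pi>: "\<pi> \<in> couplings \<mu> \<nu>"
  shows "integrable \<pi> (\<lambda>p. \<bar>fst p - c\<bar>)" "integrable \<pi> (\<lambda>p. \<bar>snd p - c\<bar>)"
    "(\<integral>p. \<bar>fst p - c\<bar> \<partial>\<pi>) = (\<integral>x. \<bar>x - c\<bar> \<partial>\<mu>)"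
    "(\<integral>p. \<bar>snd p - c\<bar> \<partial>\<pi>) = (\<integral>x. \<bar>x - c\<bar> \<partial>\<nu>)"
    "integrable \<pi> (\<lambda>p. \<bar>fst p - snd p\<bar>)"
proof -
  note [measurable] = couplingD(3,4)[OF \<pi>]
  note eq = couplingD(5,6)[OF \<pi>]
  show 1: "integrable \<pi> (\<lambda>p. \<bar>fst p - c\<bar>)" for c
    using integrable_abs_diff_const[OF assms(1), of c] unfolding eq(1)[symmetric]
    by (simp add: integrable_distr_eq)
  show 2: "integrable \<pi> (\<lambda>p. \<bar>snd p - c\<bar>)" for c
    using integrable_abs_diff_const[OF assms(2), of c] unfolding eq(2)[symmetric]
    by (simp add: integrable_distr_eq)
  show "(\<integral>p. \<bar>fst p - c\<bar> \<partial>\<pi>) = (\<integral>x. \<bar>x - c\<bar> \<partial>\<mu>)"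
    unfolding eq(1)[symmetric] by (simp add: integral_distr)
  show "(\<integral>p. \<bar>snd p - c\<bar> \<partial>\<pi>) = (\<integral>x. \<bar>x - c\<bar> \<partial>\<nu>)"
    unfolding eq(2)[symmetric] by (simp add: integral_distr)
  show "integrable \<pi> (\<lambda>p. \<bar>fst p - snd p\<bar>)"
    using Bochner_Integration.integrable_add[OF 1[of 0] 2[of 0]]
    by (rule Bochner_Integration.integrable_bound) auto
qed

lemma wasserstein_dist_le_coupling:
  assumes "\<mu> \<in> wasserstein_space X" "\<nu> \<in> wasserstein_space Y" and \<pi>: "\<pi> \<in> couplings \<mu> \<nu>"
  shows "wasserstein_dist \<mu> \<nu> \<le> (\<integral>p. \<bar>fst p - snd p\<bar> \<partial>\<pi>)"
  using wasserstein_dist_distr_le[OF couplingD(1,3,4)[OF \<pi>] integrable_coupling(5)[OF assms]]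
  by (simp add: couplingD(5,6)[OF \<pi>])

text \<open>Independence is always available as a coupling. This makes the infimum in
  \<open>wasserstein_dist\<close> one over a nonempty set and supplies a concrete competitor
  later.\<close>

lemma pair_in_couplings:
  assumes "\<mu> \<in> wasserstein_space X" "\<nu> \<in> wasserstein_space Y"
  shows "\<mu> \<Otimes>\<^sub>M \<nu> \<in> couplings \<mu> \<nu>"
proof -
  interpret M: real_distribution \<mu> using assms(1) by (rule wasserstein_spaceD)
  interpret N: real_distribution \<nu> using assms(2) by (rule wasserstein_spaceD)
  interpret pair_prob_space \<mu> \<nu> ..
  have "distr (\<mu> \<Otimes>\<^sub>M \<nu>) borel fst = distr (\<mu> \<Otimes>\<^sub>M \<nu>) \<mu> fst"
    by (rule distr_cong) auto
  also have "\<dots> = \<mu>"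
    by (rule N.distr_pair_fst)
  finally have 1: "distr (\<mu> \<Otimes>\<^sub>M \<nu>) borel fst = \<mu>" .
  have "distr (\<mu> \<Otimes>\<^sub>M \<nu>) borel snd = \<nu>"
  proof (rule measure_eqI)
    fix A assume "A \<in> sets (distr (\<mu> \<Otimes>\<^sub>M \<nu>) borel snd)"
    then have [measurable]: "A \<in> sets borel" by simp
    have "emeasure (distr (\<mu> \<Otimes>\<^sub>M \<nu>) borel snd) A = emeasure (\<mu> \<Otimes>\<^sub>M \<nu>) (UNIV \<times> A)"
      by (subst emeasure_distr) (auto intro!: arg_cong2[where f=emeasure] simp: space_pair_measure)
    also have "\<dots> = emeasure \<nu> A"
      using M.emeasure_space_1 by (subst N.emeasure_pair_measure_Times) auto
    finally show "emeasure (distr (\<mu> \<Otimes>\<^sub>M \<nu>) borel snd) A = emeasure \<nu> A" .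
  qed simp
  then show ?thesis
    using 1 prob_space_axioms by (auto simp: couplings_def intro!: sets_pair_measure_cong)
qed

text \<open>Since \<open>enn2real\<close> sends \<top> to 0, a lower bound survives the conversion
  only if the infimum is finite; the product coupling guarantees that.\<close>

lemma wasserstein_dist_geI:
  assumes "\<mu> \<in> wasserstein_space X" "\<nu> \<in> wasserstein_space Y"
    and le: "\<And>\<pi>. \<pi> \<in> couplings \<mu> \<nu> \<Longrightarrow> c \<le> (\<integral>p. \<bar>fst p - snd p\<bar> \<partial>\<pi>)"
  shows "c \<le> wasserstein_dist \<mu> \<nu>"
proof -
  let ?I = "INF \<pi>\<in>couplings \<mu> \<nu>. \<integral>\<^sup>+ p. ennreal \<bar>fst p - snd p\<bar> \<partial>\<pi>"
  have eq: "(\<integral>\<^sup>+ p. ennreal \<bar>fst p - snd p\<bar> \<partial>\<pi>) = ennreal (\<integral>p. \<bar>fst p - snd p\<bar> \<partial>\<pi>)"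
    if "\<pi> \<in> couplings \<mu> \<nu>" for \<pi>
    using integrable_coupling(5)[OF assms(1,2) that] by (intro nn_integral_eq_integral) auto
  have "ennreal c \<le> ?I"
    using le by (intro INF_greatest) (simp add: eq ennreal_leI)
  moreover have "?I \<noteq> \<top>"
    using INF_lower[OF pair_in_couplings[OF assms(1,2)], of "\<lambda>\<pi>. \<integral>\<^sup>+ p. ennreal \<bar>fst p - snd p\<bar> \<partial>\<pi>"]
    unfolding eq[OF pair_in_couplings[OF assms(1,2)]] by (metis ennreal_neq_top top_unique)
  ultimately show ?thesis
    unfolding wasserstein_dist_def by (cases ?I) (auto simp: ennreal_le_iff)
qed

text \<open>The function \<open>\<lambda>x. \<bar>x - c\<bar>\<close> is 1-Lipschitz, so this is an
  instance of the easy half of Kantorovich duality.\<close>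

lemma abs_diff_moment_le_wasserstein_dist:
  assumes "\<mu> \<in> wasserstein_space X" "\<nu> \<in> wasserstein_space Y"
  shows "\<bar>(\<integral>x. \<bar>x - c\<bar> \<partial>\<mu>) - (\<integral>x. \<bar>x - c\<bar> \<partial>\<nu>)\<bar> \<le> wasserstein_dist \<mu> \<nu>"
proof (rule wasserstein_dist_geI[OF assms])
  fix \<pi> assume \<pi>: "\<pi> \<in> couplings \<mu> \<nu>"
  note int = integrable_coupling[OF assms \<pi>]
  have "(\<integral>x. \<bar>x - c\<bar> \<partial>\<mu>) - (\<integral>x. \<bar>x - c\<bar> \<partial>\<nu>) = (\<integral>p. \<bar>fst p - c\<bar> - \<bar>snd p - c\<bar> \<partial>\<pi>)"
    using int(1,2)[of c] int(3,4)[of c] by simp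
  also have "\<bar>\<dots>\<bar> \<le> (\<integral>p. \<bar>\<bar>fst p - c\<bar> - \<bar>snd p - c\<bar>\<bar> \<partial>\<pi>)"
    by (rule integral_abs_bound)
  also have "\<dots> \<le> (\<integral>p. \<bar>fst p - snd p\<bar> \<partial>\<pi>)"
    using int by (intro integral_mono) auto
  finally show "\<bar>(\<integral>x. \<bar>x - c\<bar> \<partial>\<mu>) - (\<integral>x. \<bar>x - c\<bar> \<partial>\<nu>)\<bar> \<le> (\<integral>p. \<bar>fst p - snd p\<bar> \<partial>\<pi>)" .
qed

text \<open>This is the triangle inequality through the Dirac mass at \<open>c\<close>, integrated
  against the product coupling.\<close>

lemma wasserstein_dist_le_moments:
  assumes "\<mu> \<in> wasserstein_space X" "\<nu> \<in> wasserstein_space Y"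
  shows "wasserstein_dist \<mu> \<nu> \<le> (\<integral>x. \<bar>x - c\<bar> \<partial>\<mu>) + (\<integral>x. \<bar>x - c\<bar> \<partial>\<nu>)"
proof -
  note int = integrable_coupling[OF assms pair_in_couplings[OF assms]]
  have "(\<integral>p. \<bar>fst p - snd p\<bar> \<partial>(\<mu> \<Otimes>\<^sub>M \<nu>)) \<le> (\<integral>p. \<bar>fst p - c\<bar> + \<bar>snd p - c\<bar> \<partial>(\<mu> \<Otimes>\<^sub>M \<nu>))"
    using int by (intro integral_mono) auto
  with wasserstein_dist_le_coupling[OF assms pair_in_couplings[OF assms]] show ?thesis
    using int by simp
qed

section \<open>Distances to Dirac masses, and how they determine a measure\<close>

lemma integral_return_abs: "(\<integral>x. \<bar>x - c\<bar> \<partial>return borel (a::real)) = \<bar>a - c\<bar>"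
  by (rule integral_return) auto

text \<open>The Dirac mass at \<open>c\<close> has moment 0 about \<open>c\<close>, so the preceding
  lower and upper bounds coincide.\<close>

lemma wasserstein_dist_return:
  assumes "\<mu> \<in> wasserstein_space X"
  shows "wasserstein_dist \<mu> (return borel c) = (\<integral>x. \<bar>x - c\<bar> \<partial>\<mu>)"
    and "wasserstein_dist (return borel c) \<mu> = (\<integral>x. \<bar>x - c\<bar> \<partial>\<mu>)"
proof -
  have c: "return borel c \<in> wasserstein_space UNIV"
    by (rule return_in_wasserstein_space) auto
  have "0 \<le> (\<integral>x. \<bar>x - c\<bar> \<partial>\<mu>)"
    by (rule Bochner_Integration.integral_nonneg) simp
  then show "wasserstein_dist \<mu> (return borel c) = (\<integral>x. \<bar>x - c\<bar> \<partial>\<mu>)"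
    "wasserstein_dist (return borel c) \<mu> = (\<integral>x. \<bar>x - c\<bar> \<partial>\<mu>)"
    using abs_diff_moment_le_wasserstein_dist[OF assms c, of c] wasserstein_dist_le_moments[OF assms c, of c]
      abs_diff_moment_le_wasserstein_dist[OF c assms, of c] wasserstein_dist_le_moments[OF c assms, of c]
    by (auto simp: integral_return_abs)
qed

lemma moment_eq_0_imp_return:
  assumes "\<mu> \<in> wasserstein_space X" "(\<integral>x. \<bar>x - c\<bar> \<partial>\<mu>) = 0"
  shows "\<mu> = return borel c"
proof (rule eq_returnI)
  show "real_distribution \<mu>"
    using assms(1) by (rule wasserstein_spaceD)
  have "AE x in \<mu>. \<bar>x - c\<bar> = 0"
    using assms integrable_abs_diff_const[OF assms(1), of c]
    by (subst integral_nonneg_eq_0_iff_AE[symmetric]) auto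
  then show "AE x in \<mu>. x = c" by simp
qed

text \<open>As a function of \<open>c\<close>, the moment is convex with right derivative
  \<open>2 * cdf \<mu> c - 1\<close>. Hence the moments determine the distribution function.\<close>

lemma moments_determine_measure:
  assumes "\<mu> \<in> wasserstein_space X" "\<nu> \<in> wasserstein_space Y"
    and eq: "\<And>c. (\<integral>x. \<bar>x - c\<bar> \<partial>\<mu>) = (\<integral>x. \<bar>x - c\<bar> \<partial>\<nu>)"
  shows "\<mu> = \<nu>"
proof -
  have slope: "h * (2 * cdf \<rho> c - 1) \<le> (\<integral>x. \<bar>x - (c + h)\<bar> \<partial>\<rho>) - (\<integral>x. \<bar>x - c\<bar> \<partial>\<rho>)"
    "(\<integral>x. \<bar>x - (c + h)\<bar> \<partial>\<rho>) - (\<integral>x. \<bar>x - c\<bar> \<partial>\<rho>) \<le> h * (2 * cdf \<rho> (c + h) - 1)"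
    if \<rho>: "\<rho> \<in> wasserstein_space Z" and "0 < h" for \<rho> Z c h
  proof -
    interpret real_distribution \<rho> using \<rho> by (rule wasserstein_spaceD)
    note int = integrable_abs_diff_const[OF \<rho>]
    have "(\<integral>x. 2 * indicator {..d} x - 1 \<partial>\<rho>) = 2 * cdf \<rho> d - 1" for d
      by (subst Bochner_Integration.integral_diff)
        (auto simp: cdf_def prob_space[unfolded space_eq_univ] emeasure_eq_measure)
    then have cdf: "(\<integral>x. h * (2 * indicator {..d} x - 1) \<partial>\<rho>) = h * (2 * cdf \<rho> d - 1)" for d
      by simp
    \<comment> \<open>The increment of the moment integrand from \<open>c\<close> to
      \<open>c + h\<close> equals \<open>h\<close> for \<open>x \<le> c\<close>, equals
      \<open>- h\<close> for \<open>x \<ge> c + h\<close>, and lies between in the gap. Cutting at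
      \<open>c\<close> gives the lower bound, cutting at \<open>c + h\<close> the upper one.\<close>
    have "(\<integral>x. h * (2 * indicator {..c} x - 1) \<partial>\<rho>) \<le> (\<integral>x. \<bar>x - (c + h)\<bar> - \<bar>x - c\<bar> \<partial>\<rho>)"
      using int \<open>0 < h\<close> by (intro integral_mono) (auto split: split_indicator simp del: indicator_simps simp: emeasure_eq_measure)
    with int show "h * (2 * cdf \<rho> c - 1) \<le> (\<integral>x. \<bar>x - (c + h)\<bar> \<partial>\<rho>) - (\<integral>x. \<bar>x - c\<bar> \<partial>\<rho>)"
      by (simp only: cdf Bochner_Integration.integral_diff)
    have "(\<integral>x. \<bar>x - (c + h)\<bar> - \<bar>x - c\<bar> \<partial>\<rho>) \<le> (\<integral>x. h * (2 * indicator {..c + h} x - 1) \<partial>\<rho>)"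
      using int \<open>0 < h\<close> by (intro integral_mono) (auto split: split_indicator simp del: indicator_simps simp: emeasure_eq_measure)
    with int show "(\<integral>x. \<bar>x - (c + h)\<bar> \<partial>\<rho>) - (\<integral>x. \<bar>x - c\<bar> \<partial>\<rho>) \<le> h * (2 * cdf \<rho> (c + h) - 1)"
      by (simp only: cdf Bochner_Integration.integral_diff)
  qed
  have le: "cdf \<rho> c \<le> cdf \<sigma> c"
    if \<rho>: "\<rho> \<in> wasserstein_space Z" and \<sigma>: "\<sigma> \<in> wasserstein_space Z'"
      and eq: "\<And>c. (\<integral>x. \<bar>x - c\<bar> \<partial>\<rho>) = (\<integral>x. \<bar>x - c\<bar> \<partial>\<sigma>)" for \<rho> \<sigma> Z Z' c
  proof -
    interpret real_distribution \<sigma> using \<sigma> by (rule wasserstein_spaceD)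
    have "cdf \<rho> c \<le> cdf \<sigma> d" if "c < d" for d
    proof -
      have "(d - c) * (2 * cdf \<rho> c - 1) \<le> (d - c) * (2 * cdf \<sigma> (c + (d - c)) - 1)"
        using slope(1)[OF \<rho>, of "d - c" c] slope(2)[OF \<sigma>, of "d - c" c] that
        unfolding eq by linarith
      then show ?thesis using that by (simp add: mult_le_cancel_left_pos)
    qed
    \<comment> \<open>Letting \<open>d\<close> decrease to \<open>c\<close>, right continuity of
      \<open>cdf \<sigma>\<close> removes the gap between the two slope bounds.\<close>
    then have "eventually (\<lambda>d. cdf \<rho> c \<le> cdf \<sigma> d) (at_right c)"
      by (auto simp: eventually_at_filter)
    then show ?thesis
      using cdf_is_right_cont[of c] unfolding continuous_within
      by (intro tendsto_lowerbound[where F="at_right c"]) auto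
  qed
  have "cdf \<mu> = cdf \<nu>"
    using le[OF assms(1,2) eq] le[OF assms(2,1) eq[symmetric]] by (auto simp: fun_eq_iff intro: antisym)
  then show ?thesis
    using assms(1,2) by (intro cdf_unique wasserstein_spaceD(1))
qed

section \<open>Geodesics that can and cannot be prolonged\<close>

lemma return_geodesic_extension:
  assumes \<nu>: "\<nu> \<in> wasserstein_space UNIV" and neq: "\<nu> \<noteq> return borel a"
  obtains \<rho> where "\<rho> \<in> wasserstein_space UNIV" "0 < wasserstein_dist \<nu> \<rho>"
    "wasserstein_dist (return borel a) \<rho> = wasserstein_dist (return borel a) \<nu> + wasserstein_dist \<nu> \<rho>"
proof -
  interpret real_distribution \<nu> using \<nu> by (rule wasserstein_spaceD)
  \<comment> \<open>The dilation by the factor 2 about \<open>a\<close> moves each \<open>x\<close>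
    by exactly \<open>\<bar>x - a\<bar>\<close> and doubles the moment about \<open>a\<close>. So
    the cost of this transport equals the increase of the moment, which is also a lower bound for
    the distance.\<close>
  define f where "f x = a + 2 * (x - a)" for x :: real
  define \<rho> where "\<rho> = distr \<nu> borel f"
  have [measurable]: "f \<in> borel_measurable borel"
    unfolding f_def by measurable
  note int = integrable_abs_diff_const[OF \<nu>]
  have "\<bar>f x\<bar> = 2 * \<bar>x - a / 2\<bar>" for x
    unfolding f_def by (auto simp: abs_if)
  then have "integrable \<nu> (\<lambda>x. \<bar>f x\<bar>)"
    using int[of "a / 2"] by simp
  then have \<rho>: "\<rho> \<in> wasserstein_space UNIV"
    unfolding \<rho>_def using prob_space_axioms by (intro distr_in_wasserstein_space) auto
  have "(\<integral>x. \<bar>x - a\<bar> \<partial>\<rho>) = (\<integral>x. \<bar>2 * (x - a)\<bar> \<partial>\<nu>)"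
    unfolding \<rho>_def by (subst integral_distr) (auto simp: f_def)
  then have moment: "(\<integral>x. \<bar>x - a\<bar> \<partial>\<rho>) = 2 * (\<integral>x. \<bar>x - a\<bar> \<partial>\<nu>)"
    unfolding abs_mult by simp
  have "(\<integral>x. \<bar>x - a\<bar> \<partial>\<nu>) \<noteq> 0"
    using neq moment_eq_0_imp_return[OF \<nu>] by blast
  moreover have "0 \<le> (\<integral>x. \<bar>x - a\<bar> \<partial>\<nu>)"
    by (rule Bochner_Integration.integral_nonneg) simp
  ultimately have pos: "0 < (\<integral>x. \<bar>x - a\<bar> \<partial>\<nu>)" by linarith
  have eq: "\<bar>x - f x\<bar> = \<bar>x - a\<bar>" for x by (simp add: f_def)
  have "wasserstein_dist (distr \<nu> borel (\<lambda>x. x)) \<rho> \<le> (\<integral>x. \<bar>x - f x\<bar> \<partial>\<nu>)"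
    unfolding \<rho>_def using int[of a] prob_space_axioms
    by (intro wasserstein_dist_distr_le) (auto simp: eq)
  then have "wasserstein_dist \<nu> \<rho> \<le> (\<integral>x. \<bar>x - a\<bar> \<partial>\<nu>)"
    by (simp add: eq distr_id2)
  moreover have "(\<integral>x. \<bar>x - a\<bar> \<partial>\<nu>) \<le> wasserstein_dist \<nu> \<rho>"
    using abs_diff_moment_le_wasserstein_dist[OF \<nu> \<rho>, of a] pos by (simp add: moment)
  ultimately show thesis
    using that[OF \<rho>] pos by (simp add: wasserstein_dist_return[OF \<nu>] wasserstein_dist_return[OF \<rho>] moment)
qed

text \<open>The mean serves as \<open>c\<close>: a distribution without mass on one side of its mean
  is almost surely equal to the mean, hence a Dirac mass.\<close>

lemma mass_on_both_sides:
  assumes \<mu>: "\<mu> \<in> wasserstein_space UNIV" and neq: "\<And>c. \<mu> \<noteq> return borel c"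
  obtains c where "measure \<mu> {..<c} > 0" "measure \<mu> {c<..} > 0"
proof -
  interpret real_distribution \<mu> using \<mu> by (rule wasserstein_spaceD)
  define c where "c = (\<integral>x. x \<partial>\<mu>)"
  have "integrable \<mu> (\<lambda>x. \<bar>x\<bar>)" using \<mu> by (rule wasserstein_spaceD)
  then have int: "integrable \<mu> (\<lambda>x. x)"
    by (rule integrable_abs_cancel) simp
  have 0: "(\<integral>x. x - c \<partial>\<mu>) = 0" "(\<integral>x. c - x \<partial>\<mu>) = 0"
    using int prob_space by (simp_all add: c_def)
  have *: "\<not> (AE x in \<mu>. x = c)"
    using eq_returnI[OF wasserstein_spaceD(1)[OF \<mu>]] neq by blast
  have "measure \<mu> {..<c} \<noteq> 0"
  proof
    assume "measure \<mu> {..<c} = 0"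
    then have "AE x in \<mu>. x \<notin> {..<c}"
      by (intro AE_not_in) (auto simp: null_sets_def emeasure_eq_measure)
    then have nn: "AE x in \<mu>. 0 \<le> x - c" by (auto elim: eventually_mono)
    have "AE x in \<mu>. x - c = 0"
      using integral_nonneg_eq_0_iff_AE[OF _ nn] int 0 by simp
    with * show False by simp
  qed
  moreover have "measure \<mu> {c<..} \<noteq> 0"
  proof
    assume "measure \<mu> {c<..} = 0"
    then have "AE x in \<mu>. x \<notin> {c<..}"
      by (intro AE_not_in) (auto simp: null_sets_def emeasure_eq_measure)
    then have nn: "AE x in \<mu>. 0 \<le> c - x" by (auto elim: eventually_mono)
    have "AE x in \<mu>. c - x = 0"
      using integral_nonneg_eq_0_iff_AE[OF _ nn] int 0 by simp
    then have "AE x in \<mu>. x = c" by (auto elim: eventually_mono)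
    with * show False by simp
  qed
  ultimately show thesis
    using that[of c] by (simp add: zero_less_measure_iff)
qed

text \<open>
  The product coupling loses length on pairs lying on the same side of \<open>c\<close>, so a geodesic from
  \<open>\<mu>\<close> ends at \<open>return borel c\<close> as soon as \<open>\<mu>\<close> charges both sides of \<open>c\<close>.
\<close>

lemma geodesic_ends_at_return:
  assumes \<mu>: "\<mu> \<in> wasserstein_space UNIV" and \<rho>: "\<rho> \<in> wasserstein_space UNIV"
    and pos: "measure \<mu> {..<c} > 0" "measure \<mu> {c<..} > 0"
    and geodesic: "wasserstein_dist \<mu> \<rho> =
      wasserstein_dist \<mu> (return borel c) + wasserstein_dist (return borel c) \<rho>"
  shows "\<rho> = return borel c"
proof -
  interpret M: real_distribution \<mu> using \<mu> by (rule wasserstein_spaceD)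
  interpret R: real_distribution \<rho> using \<rho> by (rule wasserstein_spaceD)
  let ?P = "\<mu> \<Otimes>\<^sub>M \<rho>"
  \<comment> \<open>\<open>?f\<close> is the defect in the triangle inequality through
    \<open>c\<close>. It is nonnegative, and the geodesic equation makes its integral against the
    product coupling at most 0.\<close>
  let ?f = "\<lambda>p. \<bar>fst p - c\<bar> + \<bar>snd p - c\<bar> - \<bar>fst p - snd p\<bar>"
  have P: "?P \<in> couplings \<mu> \<rho>" using \<mu> \<rho> by (rule pair_in_couplings)
  note int = integrable_coupling[OF \<mu> \<rho> P]
  have "(\<integral>p. ?f p \<partial>?P) = wasserstein_dist \<mu> \<rho> - (\<integral>p. \<bar>fst p - snd p\<bar> \<partial>?P)"
    using int(1-4)[of c] int(5)
    by (simp add: geodesic wasserstein_dist_return[OF \<mu>] wasserstein_dist_return[OF \<rho>])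
  also have "\<dots> \<le> 0"
    using wasserstein_dist_le_coupling[OF \<mu> \<rho> P] by simp
  finally have "(\<integral>p. ?f p \<partial>?P) \<le> 0" .
  moreover have "0 \<le> (\<integral>p. ?f p \<partial>?P)"
    by (rule Bochner_Integration.integral_nonneg) auto
  ultimately have "(\<integral>p. ?f p \<partial>?P) = 0" by linarith
  then have ae: "AE p in ?P. ?f p = 0"
    using int by (subst integral_nonneg_eq_0_iff_AE[symmetric]) auto
  \<comment> \<open>A rectangle on which the defect is nonzero is null for the product measure; as
    \<mu> charges the side \<open>B\<close>, the side \<open>A\<close> must be null for \<rho>. It
    is used with \<open>A\<close> and \<open>B\<close> equal to the same open half-line at
    \<open>c\<close>.\<close>
  have null: "emeasure \<rho> A = 0"
    if [measurable]: "A \<in> sets borel" "B \<in> sets borel" and "measure \<mu> B > 0"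
      and f: "\<And>x y. x \<in> B \<Longrightarrow> y \<in> A \<Longrightarrow> ?f (x, y) \<noteq> 0" for A B
  proof -
    have "AE p in ?P. p \<notin> B \<times> A"
      using ae by eventually_elim (use f in force)
    then have "emeasure ?P (B \<times> A) = 0"
      by (subst (asm) AE_iff_measurable[where N="B \<times> A"]) (auto simp: space_pair_measure)
    then have "emeasure \<mu> B * emeasure \<rho> A = 0"
      by (simp add: R.emeasure_pair_measure_Times)
    with \<open>measure \<mu> B > 0\<close> show ?thesis
      by (auto simp: M.emeasure_eq_measure)
  qed
  have "emeasure \<rho> {c<..} = 0"
    by (rule null[of _ "{c<..}"]) (use pos in auto)
  moreover have "emeasure \<rho> {..<c} = 0"
    by (rule null[of _ "{..<c}"]) (use pos in auto)
  ultimately have "AE x in \<rho>. x \<notin> {c<..}" "AE x in \<rho>. x \<notin> {..<c}"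
    by (intro AE_not_in; simp add: null_sets_def)+
  then have "AE x in \<rho>. x = c"
    by eventually_elim auto
  with wasserstein_spaceD(1)[OF \<rho>] show ?thesis by (rule eq_returnI)
qed

section \<open>Isometries over the line\<close>

lemma isometriesD:
  assumes "f \<in> isometries M d"
  shows "f ` M = M" "x \<in> M \<Longrightarrow> f x \<in> M" "x \<in> M \<Longrightarrow> y \<in> M \<Longrightarrow> d (f x) (f y) = d x y"
  using assms by (auto simp: isometries_def)

text \<open>A non-Dirac image charges both sides of some \<open>c\<close>. Pull the Dirac mass at
  \<open>c\<close> back to \<nu>, prolong the geodesic from \<open>return borel a\<close> beyond
  \<nu>, and apply \<open>g\<close>: the result continues beyond \<open>return borel c\<close>,
  contradicting \<open>geodesic_ends_at_return\<close>.\<close>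

lemma isometry_return:
  assumes g: "g \<in> isometries (wasserstein_space UNIV) wasserstein_dist"
  shows "\<exists>b. g (return borel a) = return borel b"
proof (rule ccontr)
  have W: "return borel c \<in> wasserstein_space UNIV" for c :: real
    by (rule return_in_wasserstein_space) auto
  let ?\<mu> = "return borel a :: real measure"
  assume "\<nexists>b. g ?\<mu> = return borel b"
  with isometriesD(2)[OF g W] obtain c
    where c: "measure (g ?\<mu>) {..<c} > 0" "measure (g ?\<mu>) {c<..} > 0" and "g ?\<mu> \<noteq> return borel c"
    using mass_on_both_sides by metis
  moreover obtain \<nu> where \<nu>: "\<nu> \<in> wasserstein_space UNIV" "g \<nu> = return borel c"
    using W[of c] isometriesD(1)[OF g] by (metis imageE)
  ultimately have "\<nu> \<noteq> ?\<mu>" by metis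
  then obtain \<rho> where \<rho>: "\<rho> \<in> wasserstein_space UNIV" and "0 < wasserstein_dist \<nu> \<rho>"
    and eq: "wasserstein_dist ?\<mu> \<rho> = wasserstein_dist ?\<mu> \<nu> + wasserstein_dist \<nu> \<rho>"
    using return_geodesic_extension[OF \<nu>(1)] by metis
  have "g \<rho> = return borel c"
  proof (rule geodesic_ends_at_return[OF _ _ c])
    show "wasserstein_dist (g ?\<mu>) (g \<rho>) =
        wasserstein_dist (g ?\<mu>) (return borel c) + wasserstein_dist (return borel c) (g \<rho>)"
      unfolding \<nu>(2)[symmetric] using eq by (simp only: isometriesD(3)[OF g] W \<nu>(1) \<rho>)
  qed (simp_all add: isometriesD(2)[OF g] W \<rho>)
  then have "wasserstein_dist \<nu> \<rho> = wasserstein_dist (return borel c) (return borel c)"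
    using isometriesD(3)[OF g \<nu>(1) \<rho>] \<nu>(2) by simp
  also have "\<dots> = 0"
    by (simp add: wasserstein_dist_return[OF W] integral_return_abs)
  finally show False using \<open>0 < wasserstein_dist \<nu> \<rho>\<close> by simp
qed

text \<open>The moments of \<mu> are its distances to the Dirac masses, and \<open>g\<close>
  preserves these.\<close>

lemma isometry_fixing_returns_is_id:
  assumes g: "g \<in> isometries (wasserstein_space UNIV) wasserstein_dist"
    and fixed: "\<And>a. g (return borel a) = return borel a"
    and \<mu>: "\<mu> \<in> wasserstein_space UNIV"
  shows "g \<mu> = \<mu>"
proof (rule moments_determine_measure)
  show g\<mu>: "g \<mu> \<in> wasserstein_space UNIV" using g \<mu> by (rule isometriesD)
  fix c
  have "wasserstein_dist (g \<mu>) (g (return borel c)) = wasserstein_dist \<mu> (return borel c)"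
    using \<mu> by (intro isometriesD(3)[OF g] return_in_wasserstein_space) auto
  then show "(\<integral>x. \<bar>x - c\<bar> \<partial>g \<mu>) = (\<integral>x. \<bar>x - c\<bar> \<partial>\<mu>)"
    by (simp add: fixed wasserstein_dist_return[OF \<mu>] wasserstein_dist_return[OF g\<mu>])
qed (rule \<mu>)

text \<open>Isometries of the line are translations and reflections, and a nontrivial translation is
  not an involution.\<close>

lemma real_isometric_involution:
  fixes f :: "real \<Rightarrow> real"
  assumes iso: "\<And>x y. \<bar>f x - f y\<bar> = \<bar>x - y\<bar>" and inv: "\<And>x. f (f x) = x"
  shows "(\<forall>x. f x = x) \<or> (\<exists>c. \<forall>x. f x = c - x)"
proof (cases "f 0 = 0")
  case True
  then have pm: "f x = x \<or> f x = - x" for x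
    using iso[of x 0] by auto
  \<comment> \<open>Distances to 0 fix \<open>f x\<close> up to sign; the distance to
    \<open>f 1\<close> prevents the sign from changing with \<open>x\<close>.\<close>
  have dist1: "\<bar>f x - f 1\<bar> = \<bar>x - 1\<bar>" for x by (rule iso)
  from pm[of 1] show ?thesis
  proof
    assume "f 1 = 1"
    then have "f x = x" for x
      using pm[of x] dist1[of x] by (auto simp: abs_if split: if_splits)
    then show ?thesis by blast
  next
    assume "f 1 = - 1"
    then have "f x = 0 - x" for x
      using pm[of x] dist1[of x] by (auto simp: abs_if split: if_splits)
    then show ?thesis by blast
  qed
next
  case False
  \<comment> \<open>Distances to 0 leave \<open>f 0 + x\<close> and \<open>f 0 - x\<close>. Since
    \<open>f\<close> maps \<open>f 0\<close> back to 0, also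
    \<open>\<bar>f x\<bar> = \<bar>x - f 0\<bar>\<close>, which rules out the first unless
    \<open>x = 0\<close>.\<close>
  have "f x = f 0 - x" for x
    using iso[of x 0] iso[of x "f 0"] inv[of 0] False by (auto simp: abs_if split: if_splits)
  then show ?thesis by blast
qed

text \<open>This excludes a Klein four-group over the line: on Dirac masses both maps act as the
  identity or a reflection, and that action determines them.\<close>

lemma commuting_isometric_involutions:
  assumes f: "f \<in> isometries (wasserstein_space UNIV) wasserstein_dist"
    and g: "g \<in> isometries (wasserstein_space UNIV) wasserstein_dist"
    and ff: "\<And>\<mu>. \<mu> \<in> wasserstein_space UNIV \<Longrightarrow> f (f \<mu>) = \<mu>"
    and gg: "\<And>\<mu>. \<mu> \<in> wasserstein_space UNIV \<Longrightarrow> g (g \<mu>) = \<mu>"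
    and fg: "\<And>\<mu>. \<mu> \<in> wasserstein_space UNIV \<Longrightarrow> f (g \<mu>) = g (f \<mu>)"
  shows "(\<forall>\<mu>\<in>wasserstein_space UNIV. f \<mu> = \<mu>) \<or> (\<forall>\<mu>\<in>wasserstein_space UNIV. g \<mu> = \<mu>) \<or>
    (\<forall>\<mu>\<in>wasserstein_space UNIV. f \<mu> = g \<mu>)"
proof -
  have W: "return borel c \<in> wasserstein_space UNIV" for c :: real
    by (rule return_in_wasserstein_space) auto
  have dist: "wasserstein_dist (return borel a) (return borel b) = \<bar>a - b\<bar>" for a b
    by (simp add: wasserstein_dist_return[OF W] integral_return_abs)
  have inj: "a = b" if "return borel a = (return borel b :: real measure)" for a b
    using dist[of a b] dist[of b b] that by simp
  have ind: "\<exists>h'. (\<forall>a. h (return borel a) = return borel (h' a)) \<and>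
      ((\<forall>x. h' x = x) \<or> (\<exists>c. \<forall>x. h' x = c - x))"
    if h: "h \<in> isometries (wasserstein_space UNIV) wasserstein_dist"
      and hh: "\<And>\<mu>. \<mu> \<in> wasserstein_space UNIV \<Longrightarrow> h (h \<mu>) = \<mu>" for h
  proof -
    obtain h' where h': "\<And>a. h (return borel a) = return borel (h' a)"
      using isometry_return[OF h] by metis
    have "\<bar>h' x - h' y\<bar> = \<bar>x - y\<bar>" for x y
      using isometriesD(3)[OF h W W, of x y] by (simp add: h' dist)
    moreover have "h' (h' x) = x" for x
      using hh[OF W, of x] by (simp add: h' inj)
    ultimately show ?thesis
      using h' real_isometric_involution by blast
  qed
  obtain f' where f': "\<And>a. f (return borel a) = return borel (f' a)"
    "(\<forall>x. f' x = x) \<or> (\<exists>c. \<forall>x. f' x = c - x)"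
    using ind[OF f ff] by blast
  obtain g' where g': "\<And>a. g (return borel a) = return borel (g' a)"
    "(\<forall>x. g' x = x) \<or> (\<exists>c. \<forall>x. g' x = c - x)"
    using ind[OF g gg] by blast
  consider "\<forall>x. f' x = x" | "\<forall>x. g' x = x"
    | c d where "\<forall>x. f' x = c - x" "\<forall>x. g' x = d - x"
    using f'(2) g'(2) by blast
  then show ?thesis
  proof cases
    case 1
    with isometry_fixing_returns_is_id[OF f] show ?thesis by (simp add: f')
  next
    case 2
    with isometry_fixing_returns_is_id[OF g] show ?thesis by (simp add: g')
  next
    case 3
    \<comment> \<open>Commutation at 0 reads \<open>c - d = d - c\<close>.\<close>
    have "f' (g' 0) = g' (f' 0)"
      using fg[OF W, of 0] by (simp add: f' g' inj)
    with 3 have "c = d" by simp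
    \<comment> \<open>Equal reflections cancel, so this composite fixes every Dirac mass and is the
      identity. As \<open>f\<close> is an involution, \<open>f\<close> and \<open>g\<close> then
      agree.\<close>
    let ?h = "\<lambda>\<mu>\<in>wasserstein_space UNIV. f (g \<mu>)"
    have "?h ` wasserstein_space UNIV = f ` g ` wasserstein_space UNIV"
      by (simp add: image_image)
    then have h: "?h \<in> isometries (wasserstein_space UNIV) wasserstein_dist"
      using isometriesD[OF f] isometriesD[OF g] by (simp add: isometries_def)
    have "?h (return borel a) = return borel a" for a
      using 3 \<open>c = d\<close> by (simp add: W f' g')
    then have "f (g \<mu>) = \<mu>" if "\<mu> \<in> wasserstein_space UNIV" for \<mu>
      using isometry_fixing_returns_is_id[OF h _ that] that by simp
    then have "f \<mu> = g \<mu>" if "\<mu> \<in> wasserstein_space UNIV" for \<mu>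
      using ff[OF isometriesD(2)[OF g that]] that by simp
    then show ?thesis by blast
  qed
qed

section \<open>Measures on the unit interval, and the uniform law\<close>

lemma wasserstein_space_unit_intervalI:
  assumes "real_distribution \<mu>" "AE x in \<mu>. x \<in> {0..1}"
  shows "\<mu> \<in> wasserstein_space {0..1}"
proof -
  interpret real_distribution \<mu> by fact
  have "integrable \<mu> (\<lambda>x. \<bar>x\<bar>)"
    using assms(2) by (intro integrable_const_bound[where B=1]) (auto elim: eventually_mono)
  then show ?thesis
    using assms(2) prob_space_axioms by (simp add: wasserstein_space_def)
qed

abbreviation uniform01 :: "real measure" where
  "uniform01 \<equiv> uniform_measure lborel {0..1}"

interpretation uniform01: real_distribution uniform01
  by (auto simp: real_distribution_def real_distribution_axioms_def intro!: prob_space_uniform_measure)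

lemma measure_uniform01: "A \<in> sets borel \<Longrightarrow> measure uniform01 A = measure lborel ({0..1} \<inter> A)"
  by simp

lemma measure_uniform01_atMost:
  assumes "0 \<le> x"
  shows "measure uniform01 {..x} = min 1 x"
proof -
  have "{0..1} \<inter> {..x} = {0..min 1 x}" by auto
  then show ?thesis using assms by (simp add: measure_uniform01)
qed

lemma measure_uniform01_lessThan:
  assumes "0 \<le> x" "x \<le> 1"
  shows "measure uniform01 {..<x} = x"
proof -
  have "{0..1} \<inter> {..<x} = {0..<x}" using assms by auto
  then show ?thesis using assms by (simp add: measure_uniform01)
qed

lemma uniform01_reflect: "distr uniform01 borel (\<lambda>x. 1 - x) = uniform01"
proof (rule cdf_unique)
  show "cdf (distr uniform01 borel (\<lambda>x. 1 - x)) = cdf uniform01"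
  proof
    fix x :: real
    have eq: "(\<lambda>u. 1 - u) -` {..x} = {1 - x..}" by auto
    have "cdf (distr uniform01 borel (\<lambda>x. 1 - x)) x = measure lborel ({0..1} \<inter> {1 - x..})"
      unfolding cdf_def by (subst measure_distr) (auto simp: eq measure_uniform01)
    also have "{0..1} \<inter> {1 - x..} = {max 0 (1 - x)..1}" by auto
    also have "measure lborel \<dots> = measure lborel {0..min 1 x}"
      by (cases "x \<le> 1"; cases "0 \<le> x") auto
    also have "{0..min 1 x} = {0..1} \<inter> {..x}" by auto
    finally show "cdf (distr uniform01 borel (\<lambda>x. 1 - x)) x = cdf uniform01 x"
      by (simp add: cdf_def measure_uniform01)
  qed
qed (use uniform01.real_distribution_axioms uniform01.real_distribution_distr in auto)

section \<open>Exchange of distribution function and quantile function\<close>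

text \<open>
  The cumulative distribution function of \<open>\<mu>\<close> becomes the quantile function of \<open>cdf_dual \<mu>\<close>.
\<close>

definition cdf_dual :: "real measure \<Rightarrow> real measure" where
  "cdf_dual \<mu> = distr uniform01 borel (cdf \<mu>)"

lemma (in real_distribution) borel_measurable_cdf [measurable]: "cdf M \<in> borel_measurable borel"
  by (rule borel_measurable_mono) (simp add: mono_def cdf_nondecreasing)

lemma cdf_dual_in_wasserstein_space:
  assumes "real_distribution \<mu>"
  shows "cdf_dual \<mu> \<in> wasserstein_space {0..1}"
proof -
  interpret real_distribution \<mu> by fact
  show ?thesis
    unfolding cdf_dual_def
    by (intro wasserstein_space_unit_intervalI uniform01.real_distribution_distr)
      (auto simp: AE_distr_iff cdf_nonneg cdf_bounded_prob)
qed

lemma cdf_unit_interval: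
  assumes "\<mu> \<in> wasserstein_space {0..1}"
  shows "t < 0 \<Longrightarrow> cdf \<mu> t = 0" "1 \<le> t \<Longrightarrow> cdf \<mu> t = 1"
proof -
  interpret real_distribution \<mu> using assms by (rule wasserstein_spaceD)
  have ae: "AE x in \<mu>. x \<in> {0..1}" using assms by (rule wasserstein_spaceD)
  show "cdf \<mu> t = 0" if "t < 0"
    unfolding cdf_def by (subst prob_eq_0) (use ae that in \<open>auto elim: eventually_mono\<close>)
  show "cdf \<mu> t = 1" if "1 \<le> t"
    unfolding cdf_def by (subst prob_eq_1) (use ae that in \<open>auto elim: eventually_mono\<close>)
qed

text \<open>The distribution function of \<open>cdf_dual \<mu>\<close> is a generalized inverse of
  \<open>cdf \<mu>\<close>, and inverting twice recovers a right-continuous function. Concretely,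
  \<open>{s. cdf (cdf_dual \<mu>) s \<le> t}\<close> lies, within the line, between
  \<open>{..<cdf \<mu> t}\<close> and \<open>{..cdf \<mu> t}\<close>, which have the same uniform
  measure.\<close>

lemma cdf_dual_involution:
  assumes \<mu>: "\<mu> \<in> wasserstein_space {0..1}"
  shows "cdf_dual (cdf_dual \<mu>) = \<mu>"
proof -
  interpret M: real_distribution \<mu> using \<mu> by (rule wasserstein_spaceD)
  have dual: "cdf_dual \<mu> \<in> wasserstein_space {0..1}"
    by (rule cdf_dual_in_wasserstein_space) (rule M.real_distribution_axioms)
  interpret D: real_distribution "cdf_dual \<mu>" using dual by (rule wasserstein_spaceD)
  have dual2: "cdf_dual (cdf_dual \<mu>) \<in> wasserstein_space {0..1}"
    by (rule cdf_dual_in_wasserstein_space) (rule D.real_distribution_axioms)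
  have cdf_dual_eq: "cdf (cdf_dual \<nu>) s = measure uniform01 {u. cdf \<nu> u \<le> s}"
    if "real_distribution \<nu>" for \<nu> s
  proof -
    interpret real_distribution \<nu> by fact
    show ?thesis
      by (simp add: cdf_dual_def cdf_def[of "distr _ _ _"] measure_distr vimage_def del: measure_uniform_measure)
  qed
  have "cdf (cdf_dual (cdf_dual \<mu>)) t = cdf \<mu> t" for t
  proof (cases "0 \<le> t \<and> t < 1")
    case False
    then show ?thesis
      using cdf_unit_interval[OF \<mu>, of t] cdf_unit_interval[OF dual2, of t] by fastforce
  next
    case True
    have below: "cdf (cdf_dual \<mu>) s \<le> t" if "s < cdf \<mu> t" for s
    proof -
      have "{u. cdf \<mu> u \<le> s} \<subseteq> {..t}"
      proof
        fix u assume "u \<in> {u. cdf \<mu> u \<le> s}"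
        with that show "u \<in> {..t}"
          using M.cdf_nondecreasing[of t u] by (cases "t \<le> u") auto
      qed
      then have "cdf (cdf_dual \<mu>) s \<le> measure uniform01 {..t}"
        unfolding cdf_dual_eq[OF M.real_distribution_axioms]
        by (intro uniform01.finite_measure_mono) auto
      then show ?thesis using True by (simp add: measure_uniform01_atMost del: measure_uniform_measure)
    qed
    \<comment> \<open>Right continuity yields some \<open>d\<close> beyond \<open>t\<close> where
      \<open>cdf \<mu>\<close> is still below \<open>s\<close>, so the sublevel set at
      \<open>s\<close> contains all of \<open>{..d}\<close>.\<close>
    have above: "t < cdf (cdf_dual \<mu>) s" if "cdf \<mu> t < s" for s
    proof -
      have "eventually (\<lambda>d. cdf \<mu> d < s) (at_right t)"
        using M.cdf_is_right_cont[of t] that unfolding continuous_within by (rule order_tendstoD)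
      moreover have "eventually (\<lambda>d. d < 1) (at_right t)"
        using True by (intro order_tendstoD(2)[OF tendsto_ident_at]) auto
      moreover have "eventually (\<lambda>d. t < d) (at_right t)"
        by (rule eventually_at_right_less)
      ultimately have "eventually (\<lambda>d. cdf \<mu> d < s \<and> d < 1 \<and> t < d) (at_right t)"
        by eventually_elim auto
      then obtain d where d: "cdf \<mu> d < s" "d < 1" "t < d"
        using eventually_happens by force
      have [measurable]: "{u. cdf \<mu> u \<le> s} \<in> sets borel" by measurable
      have "t < measure uniform01 {..d}"
        using d True by (simp add: measure_uniform01_atMost del: measure_uniform_measure)
      also have "\<dots> \<le> cdf (cdf_dual \<mu>) s"
        unfolding cdf_dual_eq[OF M.real_distribution_axioms]
        using d by (intro uniform01.finite_measure_mono) (auto intro: order_trans[OF M.cdf_nondecreasing])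
      finally show ?thesis .
    qed
    note bounds = M.cdf_nonneg[of t] M.cdf_bounded_prob[of t]
    have [measurable]: "{s. cdf (cdf_dual \<mu>) s \<le> t} \<in> sets borel" by measurable
    have "measure uniform01 {..<cdf \<mu> t} \<le> measure uniform01 {s. cdf (cdf_dual \<mu>) s \<le> t}"
      using below by (intro uniform01.finite_measure_mono) auto
    moreover have "measure uniform01 {s. cdf (cdf_dual \<mu>) s \<le> t} \<le> measure uniform01 {..cdf \<mu> t}"
    proof (rule uniform01.finite_measure_mono)
      show "{s. cdf (cdf_dual \<mu>) s \<le> t} \<subseteq> {..cdf \<mu> t}"
        using above by (auto simp: not_less[symmetric])
    qed simp
    ultimately show ?thesis
      using bounds
      by (simp add: cdf_dual_eq[OF D.real_distribution_axioms] measure_uniform01_atMost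
          measure_uniform01_lessThan del: measure_uniform_measure)
  qed
  then show ?thesis
    by (intro cdf_unique M.real_distribution_axioms wasserstein_spaceD(1)[OF dual2]) auto
qed

text \<open>For any coupling, the gap between the distribution functions at \<open>t\<close> is at
  most the probability that \<open>t\<close> separates the two coordinates. Integrating over
  \<open>t\<close> and exchanging the integrals leaves the length of the part of
  \<open>{0..1}\<close> that separates them.\<close>

lemma integral_cdf_diff_le_wasserstein_dist:
  assumes \<mu>: "\<mu> \<in> wasserstein_space X" and \<nu>: "\<nu> \<in> wasserstein_space Y"
  shows "(\<integral>t. \<bar>cdf \<mu> t - cdf \<nu> t\<bar> \<partial>uniform01) \<le> wasserstein_dist \<mu> \<nu>"
proof (rule wasserstein_dist_geI[OF \<mu> \<nu>])
  interpret M: real_distribution \<mu> using \<mu> by (rule wasserstein_spaceD)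
  interpret N: real_distribution \<nu> using \<nu> by (rule wasserstein_spaceD)
  fix \<pi> assume \<pi>: "\<pi> \<in> couplings \<mu> \<nu>"
  interpret P: prob_space \<pi> using \<pi> by (rule couplingD)
  note [measurable] = couplingD(3,4)[OF \<pi>]
  interpret UP: pair_prob_space uniform01 \<pi> ..
  define k :: "real \<Rightarrow> real \<times> real \<Rightarrow> real" where
    "k t p = (if fst p \<le> t then 1 else 0) - (if snd p \<le> t then 1 else 0)" for t p
  have [measurable]: "(\<lambda>(t, p). k t p) \<in> borel_measurable (uniform01 \<Otimes>\<^sub>M \<pi>)"
    unfolding k_def by measurable
  have [measurable]: "k t \<in> borel_measurable \<pi>" for t
    unfolding k_def by measurable
  have [simp]: "\<bar>k t p\<bar> \<le> 1" for t p by (simp add: k_def)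
  have k_int: "integrable (uniform01 \<Otimes>\<^sub>M \<pi>) (\<lambda>(t, p). \<bar>k t p\<bar>)"
    by (rule UP.integrable_const_bound[where B=1]) auto
  have cdf_diff: "\<bar>cdf \<mu> t - cdf \<nu> t\<bar> \<le> (\<integral>p. \<bar>k t p\<bar> \<partial>\<pi>)" for t
  proof -
    have "cdf \<mu> t = measure \<pi> {p \<in> space \<pi>. fst p \<le> t}"
      unfolding couplingD(5)[OF \<pi>, symmetric] cdf_def
      by (subst measure_distr) (auto intro!: arg_cong2[where f=measure])
    also have "\<dots> = (\<integral>p. indicator {p \<in> space \<pi>. fst p \<le> t} p \<partial>\<pi>)"
      by (simp add: Int_absorb2)
    also have "\<dots> = (\<integral>p. (if fst p \<le> t then 1 else 0) \<partial>\<pi>)"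
      by (rule Bochner_Integration.integral_cong) auto
    finally have 1: "cdf \<mu> t = (\<integral>p. (if fst p \<le> t then 1 else 0) \<partial>\<pi>)" .
    have "cdf \<nu> t = measure \<pi> {p \<in> space \<pi>. snd p \<le> t}"
      unfolding couplingD(6)[OF \<pi>, symmetric] cdf_def
      by (subst measure_distr) (auto intro!: arg_cong2[where f=measure])
    also have "\<dots> = (\<integral>p. indicator {p \<in> space \<pi>. snd p \<le> t} p \<partial>\<pi>)"
      by (simp add: Int_absorb2)
    also have "\<dots> = (\<integral>p. (if snd p \<le> t then 1 else 0) \<partial>\<pi>)"
      by (rule Bochner_Integration.integral_cong) auto
    finally have 2: "cdf \<nu> t = (\<integral>p. (if snd p \<le> t then 1 else 0) \<partial>\<pi>)" .
    have "integrable \<pi> (\<lambda>p. if fst p \<le> t then 1 else 0 :: real)"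
      "integrable \<pi> (\<lambda>p. if snd p \<le> t then 1 else 0 :: real)"
      by (auto intro!: P.integrable_const_bound[where B=1])
    then have "cdf \<mu> t - cdf \<nu> t = (\<integral>p. k t p \<partial>\<pi>)"
      unfolding 1 2 k_def by (rule Bochner_Integration.integral_diff[symmetric])
    then show ?thesis
      using integral_abs_bound[of \<pi> "k t"] by simp
  qed
  have slice: "(\<integral>t. \<bar>k t p\<bar> \<partial>uniform01) \<le> \<bar>fst p - snd p\<bar>" for p
  proof -
    \<comment> \<open>The half-open form is exact: \<open>k t p\<close> is nonzero precisely when
      one coordinate is at most \<open>t\<close> and the other exceeds \<open>t\<close>.\<close>
    let ?I = "{min (fst p) (snd p)..<max (fst p) (snd p)}"
    have "(\<integral>t. \<bar>k t p\<bar> \<partial>uniform01) = (\<integral>t. indicator ?I t \<partial>uniform01)"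
      by (rule Bochner_Integration.integral_cong) (auto simp: k_def indicator_def)
    also have "\<dots> = measure lborel ({0..1} \<inter> ?I)"
      by simp
    also have "\<dots> \<le> measure lborel ?I"
      by (rule measure_mono_fmeasurable) (auto simp: fmeasurable_def min_def max_def)
    finally show ?thesis by (simp add: max_def min_def split: if_splits)
  qed
  have "(\<integral>t. \<bar>cdf \<mu> t - cdf \<nu> t\<bar> \<partial>uniform01) \<le> (\<integral>t. (\<integral>p. \<bar>k t p\<bar> \<partial>\<pi>) \<partial>uniform01)"
  proof (rule integral_mono)
    have "\<bar>cdf \<mu> t - cdf \<nu> t\<bar> \<le> 1" for t
      using M.cdf_nonneg[of t] M.cdf_bounded_prob[of t] N.cdf_nonneg[of t] N.cdf_bounded_prob[of t]
      by linarith
    then show "integrable uniform01 (\<lambda>t. \<bar>cdf \<mu> t - cdf \<nu> t\<bar>)"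
      by (intro uniform01.integrable_const_bound[where B=1]) auto
    show "integrable uniform01 (\<lambda>t. \<integral>p. \<bar>k t p\<bar> \<partial>\<pi>)"
      using UP.integrable_fst[OF k_int] by simp
  qed (rule cdf_diff)
  also have "\<dots> = (\<integral>p. (\<integral>t. \<bar>k t p\<bar> \<partial>uniform01) \<partial>\<pi>)"
    by (rule UP.Fubini_integral[symmetric, OF k_int])
  also have "\<dots> \<le> (\<integral>p. \<bar>fst p - snd p\<bar> \<partial>\<pi>)"
    using UP.integrable_snd[OF k_int] integrable_coupling(5)[OF \<mu> \<nu> \<pi>] slice
    by (intro integral_mono) auto
  finally show "(\<integral>t. \<bar>cdf \<mu> t - cdf \<nu> t\<bar> \<partial>uniform01) \<le> (\<integral>p. \<bar>fst p - snd p\<bar> \<partial>\<pi>)" .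
qed

text \<open>Evaluating both distribution functions at the same uniform variable couples the duals,
  at cost equal to the area between the graphs over \<open>{0..1}\<close>.\<close>

lemma wasserstein_dist_cdf_dual_le:
  assumes \<mu>: "\<mu> \<in> wasserstein_space X" and \<nu>: "\<nu> \<in> wasserstein_space Y"
  shows "wasserstein_dist (cdf_dual \<mu>) (cdf_dual \<nu>) \<le> wasserstein_dist \<mu> \<nu>"
proof -
  interpret M: real_distribution \<mu> using \<mu> by (rule wasserstein_spaceD)
  interpret N: real_distribution \<nu> using \<nu> by (rule wasserstein_spaceD)
  have "\<bar>cdf \<mu> t - cdf \<nu> t\<bar> \<le> 1" for t
    using M.cdf_nonneg[of t] M.cdf_bounded_prob[of t] N.cdf_nonneg[of t] N.cdf_bounded_prob[of t]
    by linarith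
  then have "integrable uniform01 (\<lambda>t. \<bar>cdf \<mu> t - cdf \<nu> t\<bar>)"
    by (intro uniform01.integrable_const_bound[where B=1]) auto
  then have "wasserstein_dist (cdf_dual \<mu>) (cdf_dual \<nu>) \<le> (\<integral>t. \<bar>cdf \<mu> t - cdf \<nu> t\<bar> \<partial>uniform01)"
    unfolding cdf_dual_def using uniform01.prob_space_axioms
    by (intro wasserstein_dist_distr_le) auto
  also have "\<dots> \<le> wasserstein_dist \<mu> \<nu>"
    using \<mu> \<nu> by (rule integral_cdf_diff_le_wasserstein_dist)
  finally show ?thesis .
qed

section \<open>Reflection of the unit interval\<close>

definition reflect :: "real measure \<Rightarrow> real measure" where
  "reflect \<mu> = distr \<mu> borel (\<lambda>x. 1 - x)"

lemma reflect_in_wasserstein_space: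
  assumes "\<mu> \<in> wasserstein_space {0..1}"
  shows "reflect \<mu> \<in> wasserstein_space {0..1}"
proof -
  interpret real_distribution \<mu> using assms by (rule wasserstein_spaceD)
  have "AE x in \<mu>. x \<in> {0..1}" using assms by (rule wasserstein_spaceD)
  then show ?thesis
    unfolding reflect_def
    by (intro wasserstein_space_unit_intervalI real_distribution_distr)
      (auto simp: AE_distr_iff elim: eventually_mono)
qed

lemma reflect_involution:
  assumes "sets \<mu> = sets borel"
  shows "reflect (reflect \<mu>) = \<mu>"
proof -
  have [measurable_cong]: "sets \<mu> = sets borel" by fact
  have "reflect (reflect \<mu>) = distr \<mu> borel (\<lambda>x. x)"
    unfolding reflect_def by (subst distr_distr) (auto simp: comp_def)
  then show ?thesis using assms by (simp add: distr_id2)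
qed

lemma wasserstein_dist_reflect_le:
  assumes \<mu>: "\<mu> \<in> wasserstein_space X" and \<nu>: "\<nu> \<in> wasserstein_space Y"
  shows "wasserstein_dist (reflect \<mu>) (reflect \<nu>) \<le> wasserstein_dist \<mu> \<nu>"
proof (rule wasserstein_dist_geI[OF \<mu> \<nu>])
  fix \<pi> assume \<pi>: "\<pi> \<in> couplings \<mu> \<nu>"
  note [measurable] = couplingD(3,4)[OF \<pi>]
  have "reflect \<mu> = distr \<pi> borel (\<lambda>p. 1 - fst p)"
    unfolding reflect_def couplingD(5)[OF \<pi>, symmetric] by (subst distr_distr) (auto simp: comp_def)
  moreover have "reflect \<nu> = distr \<pi> borel (\<lambda>p. 1 - snd p)"
    unfolding reflect_def couplingD(6)[OF \<pi>, symmetric] by (subst distr_distr) (auto simp: comp_def)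
  moreover have "\<bar>(1 - fst p) - (1 - snd p)\<bar> = \<bar>fst p - snd p\<bar>" for p :: "real \<times> real" by simp
  ultimately show "wasserstein_dist (reflect \<mu>) (reflect \<nu>) \<le> (\<integral>p. \<bar>fst p - snd p\<bar> \<partial>\<pi>)"
    using wasserstein_dist_distr_le[OF couplingD(1)[OF \<pi>], of "\<lambda>p. 1 - fst p" "\<lambda>p. 1 - snd p"]
      integrable_coupling(5)[OF \<mu> \<nu> \<pi>] by simp
qed

text \<open>The identity \<open>cdf (reflect \<mu>) u = 1 - cdf \<mu> (1 - u)\<close> can fail only
  where \<open>1 - u\<close> is an atom of \<mu>. Atoms are countable, hence null for the uniform
  law, which is itself invariant under reflection.\<close>

lemma cdf_dual_reflect:
  assumes "real_distribution \<mu>"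
  shows "cdf_dual (reflect \<mu>) = reflect (cdf_dual \<mu>)"
proof -
  interpret real_distribution \<mu> by fact
  interpret R: real_distribution "reflect \<mu>"
    unfolding reflect_def by (rule real_distribution_distr) simp
  have cdf_reflect: "cdf (reflect \<mu>) u = 1 - cdf \<mu> (1 - u)" if "measure \<mu> {1 - u} = 0" for u
  proof -
    have "cdf (reflect \<mu>) u = measure \<mu> {1 - u..}"
      unfolding cdf_def reflect_def
      by (subst measure_distr) (auto intro!: arg_cong2[where f=measure])
    also have "\<dots> = measure \<mu> (space \<mu> - {..<1 - u})"
      by (rule arg_cong2[where f=measure]) auto
    also have "\<dots> = 1 - measure \<mu> {..<1 - u}"
      by (rule prob_compl) simp
    also have "{..1 - u} = {..<1 - u} \<union> {1 - u}" by auto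
    then have "measure \<mu> {..<1 - u} = cdf \<mu> (1 - u)"
      unfolding cdf_def using that by (subst \<open>{..1 - u} = _\<close>, subst finite_measure_Union) auto
    finally show ?thesis .
  qed
  have "countable ((\<lambda>x. 1 - x) ` {x. measure \<mu> {x} \<noteq> 0})"
    by (rule countable_image[OF countable_support])
  then have "AE u in lborel. u \<notin> (\<lambda>x. 1 - x) ` {x. measure \<mu> {x} \<noteq> 0}"
    by (intro AE_not_in countable_imp_null_set_lborel)
  then have "AE u in uniform01. u \<notin> (\<lambda>x. 1 - x) ` {x. measure \<mu> {x} \<noteq> 0}"
    by (intro AE_uniform_measureI) (auto elim: eventually_mono)
  then have "AE u in uniform01. cdf (reflect \<mu>) u = 1 - cdf \<mu> (1 - u)"
  proof eventually_elim
    fix u assume "u \<notin> (\<lambda>x. 1 - x) ` {x. measure \<mu> {x} \<noteq> 0}"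
    then have "measure \<mu> {1 - u} = 0"
      by (metis (mono_tags, lifting) diff_diff_eq2 add_diff_cancel_left' image_eqI mem_Collect_eq)
    then show "cdf (reflect \<mu>) u = 1 - cdf \<mu> (1 - u)" by (rule cdf_reflect)
  qed
  then have "cdf_dual (reflect \<mu>) = distr uniform01 borel (\<lambda>u. 1 - cdf \<mu> (1 - u))"
    unfolding cdf_dual_def by (intro distr_cong_AE) auto
  also have "\<dots> = distr (distr uniform01 borel (\<lambda>x. 1 - x)) borel (\<lambda>u. 1 - cdf \<mu> u)"
    by (subst distr_distr) (auto simp: comp_def)
  also have "\<dots> = reflect (cdf_dual \<mu>)"
    unfolding uniform01_reflect reflect_def cdf_dual_def
    by (subst distr_distr) (auto simp: comp_def)
  finally show ?thesis .
qed

section \<open>Two isometric involutions over the interval\<close>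

text \<open>Applying the contraction bound to \<open>f x\<close> and \<open>f y\<close> gives the
  reverse inequality, so one-sided estimates suffice for both involutions.\<close>

lemma contractive_involution_isometry:
  assumes "\<And>x. x \<in> M \<Longrightarrow> f x \<in> M" "\<And>x. x \<in> M \<Longrightarrow> f (f x) = x"
    and "\<And>x y. x \<in> M \<Longrightarrow> y \<in> M \<Longrightarrow> d (f x) (f y) \<le> d x y"
  shows "restrict f M \<in> isometries M d"
proof -
  have "f ` M = M"
    using assms(1,2) by force
  moreover have "d (f x) (f y) = d x y" if "x \<in> M" "y \<in> M" for x y
    using assms(3)[OF that] assms(3)[of "f x" "f y"] assms(1,2) that by fastforce
  ultimately show ?thesis by (simp add: isometries_def)
qed

lemma cdf_dual_isometry:
  "restrict cdf_dual (wasserstein_space {0..1}) \<in> isometries (wasserstein_space {0..1}) wasserstein_dist"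
  by (intro contractive_involution_isometry cdf_dual_in_wasserstein_space cdf_dual_involution
      wasserstein_dist_cdf_dual_le wasserstein_spaceD(1))

lemma reflect_isometry:
  "restrict reflect (wasserstein_space {0..1}) \<in> isometries (wasserstein_space {0..1}) wasserstein_dist"
  by (intro contractive_involution_isometry reflect_in_wasserstein_space reflect_involution
      wasserstein_dist_reflect_le wasserstein_spaceD(3))

lemma reflect_return: "reflect (return borel a) = return borel (1 - a)"
  unfolding reflect_def by (rule distr_return) auto

text \<open>The distribution function is a unit step at 1/2, so the dual gives the point 0 mass 1/2,
  whereas a Dirac mass gives any point mass 0 or 1.\<close>

lemma cdf_dual_return_half: "cdf_dual (return borel (1/2)) \<noteq> return borel c"
proof
  assume *: "cdf_dual (return borel (1/2)) = return borel c"
  interpret real_distribution "return borel (1/2) :: real measure"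
    by (simp add: real_distribution_def real_distribution_axioms_def prob_space_return)
  have "cdf (return borel (1/2)) -` {0} \<inter> space uniform01 = {..<1/2}"
    by (auto simp: cdf_def measure_return indicator_def)
  then have "measure (cdf_dual (return borel (1/2))) {0} = measure uniform01 {..<1/2}"
    unfolding cdf_dual_def by (subst measure_distr) auto
  also have "\<dots> = 1 / 2"
    by (rule measure_uniform01_lessThan) auto
  finally show False
    unfolding * by (cases "c = 0") (simp_all add: measure_return indicator_def)
qed

section \<open>Consequences for extensions and for the isometry groups\<close>

theorem corollary3p8:
  shows "wasserstein_space {0..1} \<subseteq> wasserstein_space UNIV \<and>
    (\<exists>f \<in> isometries (wasserstein_space {0..1}) wasserstein_dist.
       \<not> (\<exists>g \<in> isometries (wasserstein_space UNIV) wasserstein_dist.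
             \<forall>\<mu> \<in> wasserstein_space {0..1}. g \<mu> = f \<mu>)) \<and>
    \<not> (\<exists>H. subgroup H (isom_group (wasserstein_space UNIV) wasserstein_dist) \<and>
           (isom_group (wasserstein_space UNIV) wasserstein_dist)\<lparr>carrier := H\<rparr>
             \<cong> isom_group (wasserstein_space {0..1}) wasserstein_dist)"
proof (intro conjI bexI[OF _ cdf_dual_isometry] notI)
  show "wasserstein_space {0..1} \<subseteq> wasserstein_space UNIV"
    by (rule wasserstein_space_mono) simp
next
  assume "\<exists>g \<in> isometries (wasserstein_space UNIV) wasserstein_dist.
    \<forall>\<mu> \<in> wasserstein_space {0..1}. g \<mu> = restrict cdf_dual (wasserstein_space {0..1}) \<mu>"
  then obtain g where g: "g \<in> isometries (wasserstein_space UNIV) wasserstein_dist"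
    and "\<forall>\<mu> \<in> wasserstein_space {0..1}. g \<mu> = restrict cdf_dual (wasserstein_space {0..1}) \<mu>"
    by blast
  \<comment> \<open>An extension would send this Dirac mass to its dual, which is not a Dirac
    mass.\<close>
  moreover have "return borel (1/2) \<in> wasserstein_space {0..1}"
    by (rule return_in_wasserstein_space) auto
  ultimately have "g (return borel (1/2)) = cdf_dual (return borel (1/2))"
    by simp
  with isometry_return[OF g] cdf_dual_return_half show False by metis
next
  let ?W = "wasserstein_space UNIV" and ?V = "wasserstein_space {0..1}"
  let ?G = "isom_group ?W wasserstein_dist" and ?K = "isom_group ?V wasserstein_dist"
  assume "\<exists>H. subgroup H ?G \<and> ?G\<lparr>carrier := H\<rparr> \<cong> ?K"
  then obtain H \<phi> where H: "subgroup H ?G" and \<phi>: "\<phi> \<in> iso (?G\<lparr>carrier := H\<rparr>) ?K"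
    by (auto simp: is_iso_def)
  have H_sub: "h \<in> isometries ?W wasserstein_dist" if "h \<in> H" for h
    using subgroup.subset[OF H] that by (auto simp: isom_group_def)
  have H_comp: "compose ?W g h \<in> H" if "g \<in> H" "h \<in> H" for g h
    using subgroup.m_closed[OF H that] by (simp add: isom_group_def)
  have H_one: "(\<lambda>\<mu>\<in>?W. \<mu>) \<in> H"
    using subgroup.one_closed[OF H] by (simp add: isom_group_def)
  have inj: "inj_on \<phi> H" and surj: "\<phi> ` H = isometries ?V wasserstein_dist"
    using \<phi> by (auto simp: iso_def bij_betw_def isom_group_def)
  have hom: "\<phi> (compose ?W g h) = compose ?V (\<phi> g) (\<phi> h)" if "g \<in> H" "h \<in> H" for g h
    using \<phi> that by (simp add: iso_def hom_def isom_group_def)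
  have eqI: "g = h" if "g \<in> H" "h \<in> H" "\<And>\<mu>. \<mu> \<in> ?W \<Longrightarrow> g \<mu> = h \<mu>" for g h
    using H_sub that by (intro extensionalityI[of _ ?W]) (auto simp: isometries_def)
  define e where "e = (\<lambda>\<mu>\<in>?W. \<mu>)"
  have e: "e \<in> H" "compose ?W e e = e"
    using H_one by (auto simp: e_def compose_def)
  have \<phi>e: "\<phi> e \<in> isometries ?V wasserstein_dist" using e surj by blast
  \<comment> \<open>The image \<open>\<phi> e\<close> is idempotent and maps \<open>?V\<close> onto
    itself: writing a point as \<open>\<phi> e \<nu>\<close> shows that it is fixed.\<close>
  have \<phi>_one: "\<phi> e = (\<lambda>\<mu>\<in>?V. \<mu>)"
  proof (rule extensionalityI)
    fix \<mu> assume "\<mu> \<in> ?V"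
    then obtain \<nu> where \<nu>: "\<nu> \<in> ?V" "\<mu> = \<phi> e \<nu>"
      using isometriesD(1)[OF \<phi>e] by (metis imageE)
    then have "\<phi> e \<mu> = compose ?V (\<phi> e) (\<phi> e) \<nu>"
      by (simp add: compose_eq)
    also have "\<dots> = \<mu>"
      using hom[OF e(1) e(1)] by (simp add: e(2) \<nu>(2))
    finally show "\<phi> e \<mu> = (\<lambda>\<mu>\<in>?V. \<mu>) \<mu>"
      using \<open>\<mu> \<in> ?V\<close> by simp
  qed (use \<phi>e in \<open>auto simp: isometries_def\<close>)
  obtain r where r: "r \<in> H" "\<phi> r = restrict reflect ?V"
    using surj reflect_isometry by (metis imageE)
  obtain j where j: "j \<in> H" "\<phi> j = restrict cdf_dual ?V"
    using surj cdf_dual_isometry by (metis imageE)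
  \<comment> \<open>From here the Klein four-group relations over the interval are carried back to
    \<open>H\<close> by injectivity of \<phi>.\<close>
  have "\<phi> (compose ?W r r) = \<phi> e"
    using reflect_in_wasserstein_space reflect_involution[OF wasserstein_spaceD(3)]
    unfolding hom[OF r(1) r(1)] r(2) \<phi>_one by (auto simp: compose_def)
  then have "compose ?W r r = e"
    using inj H_comp[OF r(1) r(1)] e(1) by (auto dest: inj_onD)
  from fun_cong[OF this] have rr: "r (r \<mu>) = \<mu>" if "\<mu> \<in> ?W" for \<mu>
    using that by (metis compose_eq e_def restrict_apply')
  have "\<phi> (compose ?W j j) = \<phi> e"
    using cdf_dual_in_wasserstein_space[OF wasserstein_spaceD(1)] cdf_dual_involution
    unfolding hom[OF j(1) j(1)] j(2) \<phi>_one by (auto simp: compose_def)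
  then have "compose ?W j j = e"
    using inj H_comp[OF j(1) j(1)] e(1) by (auto dest: inj_onD)
  from fun_cong[OF this] have jj: "j (j \<mu>) = \<mu>" if "\<mu> \<in> ?W" for \<mu>
    using that by (metis compose_eq e_def restrict_apply')
  have "\<phi> (compose ?W r j) = \<phi> (compose ?W j r)"
    using reflect_in_wasserstein_space cdf_dual_in_wasserstein_space[OF wasserstein_spaceD(1)]
      cdf_dual_reflect[OF wasserstein_spaceD(1)]
    unfolding hom[OF r(1) j(1)] hom[OF j(1) r(1)] r(2) j(2) by (auto simp: compose_def)
  then have "compose ?W r j = compose ?W j r"
    using inj H_comp r j by (auto dest: inj_onD)
  from fun_cong[OF this] have rj: "r (j \<mu>) = j (r \<mu>)" if "\<mu> \<in> ?W" for \<mu>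
    using that by (metis compose_eq)
  have half: "return borel (1/2) \<in> ?V" and zero: "return borel 0 \<in> ?V"
    by (auto intro!: return_in_wasserstein_space)
  have neq: "return borel 1 \<noteq> (return borel 0 :: real measure)"
    by (auto dest!: arg_cong[where f="\<lambda>M. measure M {0}"] simp: measure_return)
  \<comment> \<open>Each coincidence passes through \<phi> to the interval and fails at a Dirac
    mass: reflection moves the one at 0 to 1, and at 1/2 reflection fixes the mass while the dual is
    not Dirac.\<close>
  consider "\<forall>\<mu>\<in>?W. r \<mu> = \<mu>" | "\<forall>\<mu>\<in>?W. j \<mu> = \<mu>" | "\<forall>\<mu>\<in>?W. r \<mu> = j \<mu>"
    using commuting_isometric_involutions[OF H_sub[OF r(1)] H_sub[OF j(1)] rr jj rj] by blast
  then show False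
  proof cases
    case 1
    then have "r = e" by (intro eqI r e) (auto simp: e_def)
    then have "restrict reflect ?V = (\<lambda>\<mu>\<in>?V. \<mu>)" using r \<phi>_one by simp
    from fun_cong[OF this, of "return borel 0"] zero neq show False
      by (simp add: reflect_return)
  next
    case 2
    then have "j = e" by (intro eqI j e) (auto simp: e_def)
    then have "restrict cdf_dual ?V = (\<lambda>\<mu>\<in>?V. \<mu>)" using j \<phi>_one by simp
    from fun_cong[OF this, of "return borel (1/2)"] half cdf_dual_return_half show False
      by simp
  next
    case 3
    then have "r = j" by (intro eqI r j) auto
    then have "restrict reflect ?V = restrict cdf_dual ?V" using r j by simp
    from fun_cong[OF this, of "return borel (1/2)"] half cdf_dual_return_half[of "1/2"] show False
      by (simp add: reflect_return)
  qed
qed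

end
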